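(* Let $p\neq 2$ be a prime and let $n$ be a positive integer with $p\mid n$. Let $a_1,\dots,a_n\in\mathbf{F}_p$ with $\sum_{i=1}^na_i=0$ and let $F_0=\sum_{i=1}^na_ix_i^p$. If, at the respective steps of the recursion $\partial_kF_m=B_kF_{m-1}$ ($k=1,\dots,n$; $m=1,2$), one takes $F_1,F_2\in\mathbf{F}_p[x_1,\dots,x_n]$ homogeneous of degree $p$ and including no $p$-th powers (no monomials $x_i^p$), then these polynomials exist and are given by $$F_1=-\sum_{1\le i<j\le n}\ \sum_{\substack{r,s>0\\ r+s=p}}\frac{ra_i+sa_j}{rs}\,x_i^rx_j^s$$ and $$F_2=\sum_{i<j<k}\ \sum_{\substack{r,s,t>0\\ r+s+t=p}}\left(\frac{ra_i+sa_j+ta_k}{rst}\right)x_i^rx_j^sx_k^t+\sum_{i<j}\ \sum_{\substack{r,s>0\\ r+s=p}}\frac{a_i-a_j}{r}\left(\frac1s-2\sum_{d=1}^{s}\frac1d\right)x_i^rx_j^s.$$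
   Context: $\partial_k=\frac{\partial}{\partial x_k}$ and $B_k=\sum_{j\neq k}\frac{1}{x_k-x_j}(1-s_{kj})$ on $\mathbf{F}_p[x_1,\dots,x_n]$, where $s_{kj}$ is the transposition swapping $x_k$ and $x_j$. (Thus $D_k=\partial_k-cB_k$ are the Dunkl operators of the rational Cherednik algebra of $S_n$ acting on its polynomial representation, and a formal series $\sum_mc^mF_m$ is killed by all $D_k$ iff $\partial_kF_0=0$ and $\partial_kF_m=B_kF_{m-1}$ for all $m\ge1$ and all $k$.) Fractions in the formulas are evaluated in $\mathbf{F}_p$; all denominators are integers between $1$ and $p-1$ or products of such. *)

theory Defs
  imports "HOL-Library.Poly_Mapping" "HOL-Combinatorics.Transposition"
    "Berlekamp_Zassenhaus.Finite_Field"
begin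

text \<open>
  A monomial is a finitely supported exponent vector \<open>m :: nat \<Rightarrow>\<^sub>0 nat\<close> (the variable
  \<open>x\<^sub>i\<close> has exponent \<open>lookup m i\<close>), a polynomial is a finitely supported family of
  coefficients.  The library's multiplication on \<^typ>\<open>(nat \<Rightarrow>\<^sub>0 nat) \<Rightarrow>\<^sub>0 'a\<close>
  is multiplication of polynomials.  There are infinitely many variables; the ring
  \<open>R[x\<^sub>1, ..., x\<^sub>n]\<close> is the subset \<open>polys n\<close>.
\<close>

type_synonym 'a mpoly = "(nat \<Rightarrow>\<^sub>0 nat) \<Rightarrow>\<^sub>0 'a"

definition var :: "nat \<Rightarrow> 'a::comm_ring_1 mpoly" where
  "var i = Poly_Mapping.single (Poly_Mapping.single i 1) 1"

definition cst :: "'a::comm_ring_1 \<Rightarrow> 'a mpoly" where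
  "cst c = Poly_Mapping.single 0 c"

definition polys :: "nat \<Rightarrow> 'a::comm_ring_1 mpoly set" where
  "polys n = {f. \<forall>m\<in>Poly_Mapping.keys f. Poly_Mapping.keys m \<subseteq> {1..n}}"

definition homogeneous :: "nat \<Rightarrow> 'a::comm_ring_1 mpoly \<Rightarrow> bool" where
  "homogeneous d f \<longleftrightarrow>
     (\<forall>m\<in>Poly_Mapping.keys f. (\<Sum>i\<in>Poly_Mapping.keys m. Poly_Mapping.lookup m i) = d)"

text \<open>In \<open>partial\<close>, the subtraction of exponent vectors truncates only where the
  coefficient \<open>lookup m k\<close> is zero.\<close>

definition partial :: "nat \<Rightarrow> 'a::comm_ring_1 mpoly \<Rightarrow> 'a mpoly" where
  "partial k f = (\<Sum>m\<in>Poly_Mapping.keys f.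
     Poly_Mapping.single (m - Poly_Mapping.single k 1)
       (of_nat (Poly_Mapping.lookup m k) * Poly_Mapping.lookup f m))"

text \<open>\<open>map_key\<close> is precomposition; as a transposition is its own inverse, the outer
  \<open>map_key\<close> moves the coefficient of \<open>m\<close> to the monomial with exponents \<open>k\<close>
  and \<open>j\<close> exchanged.\<close>

definition swap :: "nat \<Rightarrow> nat \<Rightarrow> 'a::comm_ring_1 mpoly \<Rightarrow> 'a mpoly" where
  "swap k j f = Poly_Mapping.map_key (Poly_Mapping.map_key (transpose k j)) f"

text \<open>The operator \<open>1/(x\<^sub>k - x\<^sub>j) (1 - s\<^sub>k\<^sub>j)\<close>: the exact quotient in the polynomial
  ring, which exists and is unique for \<open>k \<noteq> j\<close> by \<open>ex1_div_diff\<close> below.\<close>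

definition div_diff :: "nat \<Rightarrow> nat \<Rightarrow> 'a::idom mpoly \<Rightarrow> 'a mpoly" where
  "div_diff k j f = (THE q. (var k - var j) * q = f - swap k j f)"

definition B :: "nat \<Rightarrow> nat \<Rightarrow> 'a::idom mpoly \<Rightarrow> 'a mpoly" where
  "B n k f = (\<Sum>j\<in>{1..n} - {k}. div_diff k j f)"

text \<open>\<open>next_term p n G F\<close>: \<open>F\<close> is an admissible choice for the term following
  \<open>G\<close> in the recursion.\<close>

definition next_term :: "nat \<Rightarrow> nat \<Rightarrow> 'a::idom mpoly \<Rightarrow> 'a mpoly \<Rightarrow> bool" where
  "next_term p n G F \<longleftrightarrow>
     F \<in> polys n \<and> homogeneous p F \<and>
     (\<forall>i\<in>{1..n}. Poly_Mapping.lookup F (Poly_Mapping.single i p) = 0) \<and>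
     (\<forall>k\<in>{1..n}. partial k F = B n k G)"

definition F0 :: "nat \<Rightarrow> nat \<Rightarrow> (nat \<Rightarrow> 'a::field) \<Rightarrow> 'a mpoly" where
  "F0 p n a = (\<Sum>i\<in>{1..n}. cst (a i) * var i ^ p)"

definition F1 :: "nat \<Rightarrow> nat \<Rightarrow> (nat \<Rightarrow> 'a::field) \<Rightarrow> 'a mpoly" where
  "F1 p n a =
     - (\<Sum>(i, j) \<in> {(i, j). 1 \<le> i \<and> i < j \<and> j \<le> n}.
         \<Sum>(r, s) \<in> {(r, s). r > 0 \<and> s > 0 \<and> r + s = p}.
           cst ((of_nat r * a i + of_nat s * a j) / (of_nat r * of_nat s))
             * var i ^ r * var j ^ s)"

definition F2 :: "nat \<Rightarrow> nat \<Rightarrow> (nat \<Rightarrow> 'a::field) \<Rightarrow> 'a mpoly" where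
  "F2 p n a =
     (\<Sum>(i, j, k) \<in> {(i, j, k). 1 \<le> i \<and> i < j \<and> j < k \<and> k \<le> n}.
         \<Sum>(r, s, t) \<in> {(r, s, t). r > 0 \<and> s > 0 \<and> t > 0 \<and> r + s + t = p}.
           cst ((of_nat r * a i + of_nat s * a j + of_nat t * a k)
                  / (of_nat r * of_nat s * of_nat t))
             * var i ^ r * var j ^ s * var k ^ t)
     + (\<Sum>(i, j) \<in> {(i, j). 1 \<le> i \<and> i < j \<and> j \<le> n}.
         \<Sum>(r, s) \<in> {(r, s). r > 0 \<and> s > 0 \<and> r + s = p}.
           cst ((a i - a j) / of_nat r * (1 / of_nat s - 2 * (\<Sum>d = 1..s. 1 / of_nat d)))
             * var i ^ r * var j ^ s)"

lemma map_key_transpose_invol: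
  "Poly_Mapping.map_key (transpose k j) (Poly_Mapping.map_key (transpose k j) m) = m"
  by (rule poly_mapping_eqI) (simp add: map_key.rep_eq)

lemma inj_map_key_transpose:
  "inj (Poly_Mapping.map_key (transpose k j) :: (nat \<Rightarrow>\<^sub>0 nat) \<Rightarrow> _)"
  by (rule inj_on_inverseI) (rule map_key_transpose_invol)

lemma swap_single:
  "swap k j (Poly_Mapping.single m c) =
   Poly_Mapping.single (Poly_Mapping.map_key (transpose k j) m) c"
  unfolding swap_def
  using map_key_single[OF inj_map_key_transpose,
      of k j "Poly_Mapping.map_key (transpose k j) m" c]
  by (simp add: map_key_transpose_invol)

lemma swap_add: "swap k j (f + g) = swap k j f + swap k j g"
  unfolding swap_def by (rule map_key_plus[OF inj_map_key_transpose])

lemma var_power: "var i ^ e = Poly_Mapping.single (Poly_Mapping.single i e) 1"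
  by (induction e) (simp_all add: var_def mult_single single_add[symmetric])

lemma var_diff_dvd_monom:
  assumes "k \<noteq> j"
  shows "var k - var j dvd
    Poly_Mapping.single m (c::'a::idom) - swap k j (Poly_Mapping.single m c)"
proof -
  let ?u = "Poly_Mapping.lookup m k" and ?v = "Poly_Mapping.lookup m j"
  let ?e = "min ?u ?v"
  define r where "r = m - Poly_Mapping.single k ?u - Poly_Mapping.single j ?v
     + Poly_Mapping.single k ?e + Poly_Mapping.single j ?e"
  have m: "m = r + Poly_Mapping.single k (?u - ?e) + Poly_Mapping.single j (?v - ?e)"
    using assms unfolding r_def
    by (intro poly_mapping_eqI)
      (auto simp: lookup_add lookup_minus lookup_single when_def)
  have m': "Poly_Mapping.map_key (transpose k j) m =
      r + Poly_Mapping.single j (?u - ?e) + Poly_Mapping.single k (?v - ?e)"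
    using assms unfolding r_def
    by (intro poly_mapping_eqI)
      (auto simp: lookup_add lookup_minus lookup_single when_def map_key.rep_eq transpose_def)
  have s: "Poly_Mapping.single (r + Poly_Mapping.single x a + Poly_Mapping.single y b) c
      = Poly_Mapping.single r c * (var x ^ a * var y ^ b)" for x y a b
    by (simp add: var_power mult_single add.assoc)
  have 1: "Poly_Mapping.single m c
      = Poly_Mapping.single r c * (var k ^ (?u - ?e) * var j ^ (?v - ?e))"
    using arg_cong[OF m, of "\<lambda>x. Poly_Mapping.single x c"] unfolding s .
  have 2: "swap k j (Poly_Mapping.single m c)
      = Poly_Mapping.single r c * (var j ^ (?u - ?e) * var k ^ (?v - ?e))"
    using arg_cong[OF m', of "\<lambda>x. Poly_Mapping.single x c"] unfolding s swap_single .
  have pow: "var k - var j dvd (var k ^ d - var j ^ d :: 'a mpoly)" for d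
    unfolding power_diff_sumr2 by (rule dvd_triv_left)
  have "var k - var j dvd - (var k ^ d - var j ^ d :: 'a mpoly)" for d
    using pow[of d] by (subst dvd_minus_iff)
  then have pow': "var k - var j dvd (var j ^ d - var k ^ d :: 'a mpoly)" for d
    unfolding minus_diff_eq .
  have "var k - var j dvd (var k ^ (?u - ?e) * var j ^ (?v - ?e)
       - var j ^ (?u - ?e) * var k ^ (?v - ?e) :: 'a mpoly)"
    using pow[of "?u - ?v"] pow'[of "?v - ?u"] by (cases "?u \<le> ?v") (simp_all add: min_def)
  then show ?thesis
    unfolding 2 by (subst 1) (simp only: right_diff_distrib[symmetric] dvd_mult)
qed

lemma var_diff_dvd:
  assumes "k \<noteq> j"
  shows "var k - var j dvd (f::'a::idom mpoly) - swap k j f"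
proof (induction f rule: update_induct)
  case const
  then show ?case by (simp add: swap_def inj_map_key_transpose)
next
  case (update f m c)
  have "Poly_Mapping.update m c f = f + Poly_Mapping.single m c"
    using update(1)
    by (intro poly_mapping_eqI)
      (auto simp: lookup_update lookup_add lookup_single when_def in_keys_iff)
  then have "Poly_Mapping.update m c f - swap k j (Poly_Mapping.update m c f)
    = (f - swap k j f) + (Poly_Mapping.single m c - swap k j (Poly_Mapping.single m c))"
    by (simp add: swap_add)
  then show ?case
    using dvd_add[OF update(3) var_diff_dvd_monom[OF assms, of m c]] by (simp only:)
qed

lemma var_diff_nonzero:
  assumes "k \<noteq> j" shows "var k - var j \<noteq> (0::'a::idom mpoly)"
proof
  assume "var k - var j = (0::'a mpoly)"
  then have "Poly_Mapping.lookup (var k :: 'a mpoly) (Poly_Mapping.single k 1) =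
      Poly_Mapping.lookup (var j) (Poly_Mapping.single k 1)" by simp
  moreover have "Poly_Mapping.single j 1 \<noteq> Poly_Mapping.single k (1::nat)"
    using assms by (auto dest: arg_cong[where f = "\<lambda>m. Poly_Mapping.lookup m j"] simp: lookup_single)
  ultimately show False by (simp add: var_def lookup_single)
qed

lemma ex1_div_diff:
  assumes "k \<noteq> j"
  shows "\<exists>!q. (var k - var j) * q = (f::'a::idom mpoly) - swap k j f"
proof -
  from var_diff_dvd[OF assms, of f] obtain q where "f - swap k j f = (var k - var j) * q"
    by (rule dvdE)
  then show ?thesis using var_diff_nonzero[OF assms, where ?'a = 'a]
    by (intro ex1I[of _ q]) (simp_all only: mult_cancel_left simp_thms)
qed

end

theory Submission
  imports Defs
begin

text \<open>
  Write \<open>L(x, y) = \<Sum> x\<^sup>r y\<^sup>s / r\<close>, summed over \<open>r, s > 0\<close> with \<open>r + s = p\<close>; as \<open>r = -s\<close> in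
  characteristic \<open>p\<close>, it is antisymmetric.  Then \<open>F\<^sub>1 = \<Sum> a\<^sub>i P\<^sub>i\<close> with \<open>P\<^sub>i = \<Sum>\<^sub>l L(x\<^sub>i, x\<^sub>l)\<close>,
  just as \<open>F\<^sub>0 = \<Sum> a\<^sub>i x\<^sub>i\<^sup>p\<close>.  In both cases \<open>s\<^sub>k\<^sub>j\<close> permutes the family \<open>P\<close>, so that
  \<open>B\<^sub>k\<close> yields \<open>\<Sum>\<^sub>j (a\<^sub>k - a\<^sub>j) (P\<^sub>k - P\<^sub>j) / (x\<^sub>k - x\<^sub>j)\<close>.  The part of the quotient that does not
  depend on \<open>j\<close> is multiplied by \<open>\<Sum>\<^sub>j (a\<^sub>k - a\<^sub>j) = n a\<^sub>k - \<Sum> a\<^sub>j = 0\<close>, and the rest is the derivative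
  of the next term.  For \<open>F\<^sub>2\<close>, the rest is a sum of monomials in \<open>x\<^sub>k, x\<^sub>j, x\<^sub>i\<close>; the
  coincidences \<open>i = j\<close> and \<open>i = k\<close> produce the harmonic sums, which satisfy \<open>H\<^sub>r\<^sub>-\<^sub>1 = H\<^sub>s\<close>
  for \<open>r + s = p\<close>.  A polynomial of degree \<open>p\<close> without \<open>p\<close>-th powers is determined by its
  partial derivatives, because the degree is too small for any other monomial to be killed.
\<close>

subsection \<open>Derivations and transpositions\<close>

text \<open>Additive claims reduce to monomials; applied to both factors, the rule reduces the
  product laws of \<open>partial\<close> and \<open>swap\<close> to pairs of monomials.\<close>

lemma mpoly_induct [case_names single add]:
  fixes f :: "'a::comm_ring_1 mpoly"
  assumes single: "\<And>m c. P (Poly_Mapping.single m c)"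
    and add: "\<And>f g. P f \<Longrightarrow> P g \<Longrightarrow> P (f + g)"
  shows "P f"
proof (induction f rule: update_induct)
  case const
  then show ?case using single[of 0 0] by simp
next
  case (update f m c)
  have "Poly_Mapping.update m c f = f + Poly_Mapping.single m c"
    using update(1)
    by (intro poly_mapping_eqI)
      (auto simp: lookup_update lookup_add lookup_single when_def in_keys_iff)
  then show ?case using add[OF update(3) single] by simp
qed

lemma cst_0 [simp]: "cst 0 = 0" and cst_1 [simp]: "cst 1 = 1"
  by (simp_all add: cst_def)

lemma cst_add: "cst (a + b) = cst a + cst b"
  by (simp add: cst_def single_add)

lemma cst_diff: "cst (a - b) = cst a - cst b"
  by (simp add: cst_def single_diff)

lemma cst_uminus: "cst (- a) = - cst a"
  by (simp add: cst_def single_uminus)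

lemma cst_mult: "cst (a * b) = cst a * cst b"
  by (simp add: cst_def mult_single)

lemma cst_sum: "cst (sum f A) = (\<Sum>x\<in>A. cst (f x))"
  by (induction A rule: infinite_finite_induct) (simp_all add: cst_add)

lemma lookup_partial:
  "Poly_Mapping.lookup (partial k f) m =
    of_nat (Suc (Poly_Mapping.lookup m k)) * Poly_Mapping.lookup f (m + Poly_Mapping.single k 1)"
proof -
  let ?e = "Poly_Mapping.single k (1::nat)"
  \<comment> \<open>Truncation in \<open>m' - ?e\<close> matters only if \<open>k\<close> has
    exponent zero in \<open>m'\<close>, and then both values are zero.\<close>
  have eq: "(of_nat (Poly_Mapping.lookup m' k) * Poly_Mapping.lookup f m' when m' - ?e = m) =
      (of_nat (Poly_Mapping.lookup m' k) * Poly_Mapping.lookup f m' when m' = m + ?e)" for m'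
  proof (cases "Poly_Mapping.lookup m' k = 0")
    case False
    then have "m' = m' - ?e + ?e"
      by (intro poly_mapping_eqI) (auto simp: lookup_add lookup_minus lookup_single when_def)
    moreover have "m + ?e - ?e = m"
      by (intro poly_mapping_eqI) (auto simp: lookup_add lookup_minus lookup_single when_def)
    ultimately have "m' - ?e = m \<longleftrightarrow> m' = m + ?e" by metis
    then show ?thesis by simp
  qed (simp add: when_def)
  have "Poly_Mapping.lookup (partial k f) m = (\<Sum>m'\<in>Poly_Mapping.keys f.
      of_nat (Poly_Mapping.lookup m' k) * Poly_Mapping.lookup f m' when m' = m + ?e)"
    unfolding partial_def lookup_sum lookup_single eq ..
  also have "\<dots> = of_nat (Poly_Mapping.lookup (m + ?e) k) * Poly_Mapping.lookup f (m + ?e)"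
    by (cases "m + ?e \<in> Poly_Mapping.keys f")
      (auto simp: when_def not_in_keys_iff_lookup_eq_zero)
  finally show ?thesis by (simp add: lookup_add)
qed

lemma partial_0 [simp]: "partial k 0 = 0"
  by (rule poly_mapping_eqI) (simp add: lookup_partial)

lemma partial_add: "partial k (f + g) = partial k f + partial k g"
  by (rule poly_mapping_eqI) (simp add: lookup_partial lookup_add algebra_simps)

lemma partial_sum: "partial k (sum f A) = (\<Sum>x\<in>A. partial k (f x))"
  by (induction A rule: infinite_finite_induct) (simp_all add: partial_add)

lemma partial_single:
  "partial k (Poly_Mapping.single m c) =
    Poly_Mapping.single (m - Poly_Mapping.single k 1) (of_nat (Poly_Mapping.lookup m k) * c)"
  by (cases "c = 0") (simp_all add: partial_def)

lemma partial_mult: "partial k (f * g) = partial k f * g + f * partial k g"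
proof (induction f rule: mpoly_induct)
  case (single m c)
  show ?case
  proof (induction g rule: mpoly_induct)
    case (single m' c')
    let ?e = "Poly_Mapping.single k (1::nat)"
    have shift: "x - ?e + y = x + y - ?e" if "Poly_Mapping.lookup x k > 0" for x y
      using that by (intro poly_mapping_eqI) (auto simp: lookup_add lookup_minus lookup_single when_def)
    \<comment> \<open>If \<open>k\<close> has exponent zero in \<open>x\<close>, the two truncated
      monomials may differ, but both carry the coefficient zero.\<close>
    have *: "Poly_Mapping.single (x - ?e + y) (of_nat (Poly_Mapping.lookup x k) * c) =
        Poly_Mapping.single (x + y - ?e) (of_nat (Poly_Mapping.lookup x k) * c)" for x y and c :: 'a
      using shift[of x y] by (cases "Poly_Mapping.lookup x k = 0") simp_all
    show ?case
      using *[of m m' "c * c'"] *[of m' m "c * c'"]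
      by (simp add: partial_single mult_single lookup_add single_add[symmetric] algebra_simps)
  next
    case (add f g)
    then show ?case by (simp add: partial_add algebra_simps)
  qed
next
  case (add f h)
  then show ?case by (simp add: partial_add algebra_simps)
qed

lemma partial_cst [simp]: "partial k (cst c) = 0"
  by (simp add: cst_def partial_single)

lemma partial_var_power:
  "partial k (var i ^ r) = (if i = k then cst (of_nat r) * var k ^ (r - 1) else 0)"
  by (auto simp: var_power partial_single cst_def mult_single lookup_single single_diff[symmetric]
      simp del: single_of_nat)

lemma swap_0 [simp]: "swap k j 0 = 0"
  by (simp add: swap_def inj_map_key_transpose)

lemma swap_sum: "swap k j (sum f A) = (\<Sum>x\<in>A. swap k j (f x))"
  by (induction A rule: infinite_finite_induct) (simp_all add: swap_add)

lemma swap_mult: "swap k j (f * g) = swap k j f * swap k j g"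
proof (induction f rule: mpoly_induct)
  case (single m c)
  show ?case
  proof (induction g rule: mpoly_induct)
    case (single m' c')
    show ?case by (simp add: swap_single mult_single map_key_plus)
  qed (simp add: swap_add algebra_simps)
qed (simp add: swap_add algebra_simps)

lemma swap_cst [simp]: "swap k j (cst c) = cst c"
  by (simp add: cst_def swap_single)

lemma swap_var_power [simp]: "swap k j (var i ^ r) = var (transpose k j i) ^ r"
proof -
  have "Poly_Mapping.map_key (transpose k j) (Poly_Mapping.single i r) =
      Poly_Mapping.single (transpose k j i) r"
    by (rule poly_mapping_eqI) (auto simp: map_key.rep_eq lookup_single when_def transpose_def)
  then show ?thesis by (simp add: var_power swap_single)
qed

section \<open>Divided differences\<close>

lemma div_diff_eqI:
  fixes f :: "'a::idom mpoly"
  assumes "k \<noteq> j" "(var k - var j) * q = f - swap k j f"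
  shows "div_diff k j f = q"
  unfolding div_diff_def
  by (rule the1_equality[OF ex1_div_diff[OF assms(1)] assms(2)])

text \<open>The terms with \<open>i\<close> other than \<open>k\<close> and \<open>j\<close> are
  fixed by the transposition and cancel; the two exchanged ones combine to
  \<open>(a k - a j) * (P k - P j)\<close>. The family consists of pure powers for \<open>F0\<close>
  and of sums of \<open>log_form\<close> for \<open>F1\<close>.\<close>

lemma div_diff_equivariant_family:
  fixes P :: "nat \<Rightarrow> 'a::idom mpoly"
  assumes "finite I" "k \<in> I" "j \<in> I" "k \<noteq> j"
    and P: "\<And>i. i \<in> I \<Longrightarrow> swap k j (P i) = P (transpose k j i)"
    and Q: "(var k - var j) * Q = P k - P j"
  shows "div_diff k j (\<Sum>i\<in>I. cst (a i) * P i) = cst (a k - a j) * Q"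
proof (rule div_diff_eqI[OF \<open>k \<noteq> j\<close>])
  have I: "I = insert k (insert j (I - {k, j}))" using assms by auto
  have "(\<Sum>i\<in>I. cst (a i) * P i) - swap k j (\<Sum>i\<in>I. cst (a i) * P i)
      = (\<Sum>i\<in>I. cst (a i) * (P i - P (transpose k j i)))"
    by (simp add: swap_sum swap_mult P sum_subtractf right_diff_distrib)
  also have "\<dots> = cst (a k) * (P k - P j) + cst (a j) * (P j - P k)
      + (\<Sum>i\<in>I - {k, j}. cst (a i) * (P i - P (transpose k j i)))"
    using assms by (subst I) (simp add: add.assoc)
  also have "(\<Sum>i\<in>I - {k, j}. cst (a i) * (P i - P (transpose k j i))) = 0"
    by (rule sum.neutral) simp
  also have "cst (a k) * (P k - P j) + cst (a j) * (P j - P k) + 0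
      = (var k - var j) * (cst (a k - a j) * Q)"
    by (simp only: mult.left_commute[of _ "cst _"] Q) (simp add: cst_diff algebra_simps)
  finally show "(var k - var j) * (cst (a k - a j) * Q) =
      (\<Sum>i\<in>I. cst (a i) * P i) - swap k j (\<Sum>i\<in>I. cst (a i) * P i)" by simp
qed

subsection \<open>Polynomials without pure powers\<close>

lemma monom3_eq_single:
  "cst c * var i ^ r * var j ^ s * var k ^ t = Poly_Mapping.single
    (Poly_Mapping.single i r + Poly_Mapping.single j s + Poly_Mapping.single k t) c"
  by (simp add: cst_def var_power mult_single)

text \<open>This isolates the conditions in \<open>next_term\<close> that do not involve the
  preceding term. They restrict the occurring monomials one by one, hence are inherited by
  sums.\<close>

definition mixed :: "nat \<Rightarrow> nat \<Rightarrow> 'a::comm_ring_1 mpoly \<Rightarrow> bool" where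
  "mixed n p F \<longleftrightarrow> F \<in> polys n \<and> homogeneous p F \<and>
    (\<forall>i\<in>{1..n}. Poly_Mapping.lookup F (Poly_Mapping.single i p) = 0)"

lemma mixed_iff:
  "mixed n p F \<longleftrightarrow> (\<forall>m\<in>Poly_Mapping.keys F. Poly_Mapping.keys m \<subseteq> {1..n} \<and>
    (\<Sum>i\<in>Poly_Mapping.keys m. Poly_Mapping.lookup m i) = p \<and>
    (\<forall>i\<in>{1..n}. m \<noteq> Poly_Mapping.single i p))"
  unfolding mixed_def polys_def homogeneous_def not_in_keys_iff_lookup_eq_zero[symmetric] by blast

lemma mixed_uminus: "mixed n p F \<Longrightarrow> mixed n p (- F)"
  by (simp add: mixed_iff in_keys_iff)

lemma mixed_add: "mixed n p F \<Longrightarrow> mixed n p G \<Longrightarrow> mixed n p (F + G)"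
  unfolding mixed_iff using keys_add[of F G] by blast

lemma mixed_sum: "(\<And>x. x \<in> A \<Longrightarrow> mixed n p (F x)) \<Longrightarrow> mixed n p (sum F A)"
  unfolding mixed_iff using keys_sum[of F A] by blast

text \<open>Two distinct variables with positive exponents prevent a pure power. The exponent
  \<open>t\<close> may be zero, which yields the case of two variables.\<close>

lemma mixed_monom3:
  assumes "i \<in> {1..n}" "j \<in> {1..n}" "k \<in> {1..n}" "i \<noteq> j" "r > 0" "s > 0" "r + s + t = p"
  shows "mixed n p (cst c * var i ^ r * var j ^ s * var k ^ t)"
proof -
  let ?m = "Poly_Mapping.single i r + Poly_Mapping.single j s + Poly_Mapping.single k t"
  have sub: "Poly_Mapping.keys ?m \<subseteq> {1..n}"
    using assms by (auto simp: in_keys_iff lookup_add lookup_single when_def split: if_splits)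
  have "(\<Sum>x\<in>Poly_Mapping.keys ?m. Poly_Mapping.lookup ?m x) =
      (\<Sum>x\<in>{1..n}. Poly_Mapping.lookup ?m x)"
    by (rule sum.mono_neutral_left) (use sub in \<open>auto simp: not_in_keys_iff_lookup_eq_zero\<close>)
  also have "\<dots> = p"
    using assms by (simp add: lookup_add lookup_single when_def sum.distrib)
  finally have deg: "(\<Sum>x\<in>Poly_Mapping.keys ?m. Poly_Mapping.lookup ?m x) = p" .
  have "?m \<noteq> Poly_Mapping.single l p" for l
  proof
    assume eq: "?m = Poly_Mapping.single l p"
    have "Poly_Mapping.lookup ?m i > 0" "Poly_Mapping.lookup ?m j > 0"
      using assms by (simp_all add: lookup_add)
    then show False using \<open>i \<noteq> j\<close> unfolding eq by (simp add: lookup_single when_def split: if_splits)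
  qed
  then show ?thesis
    unfolding monom3_eq_single mixed_iff using sub deg by simp
qed

lemma mixed_monom2:
  assumes "i \<in> {1..n}" "j \<in> {1..n}" "i \<noteq> j" "r > 0" "s > 0" "r + s = p"
  shows "mixed n p (cst c * var i ^ r * var j ^ s)"
  using mixed_monom3[of i n j i r s 0 p c] assms by simp

text \<open>If the coefficients at \<open>m\<close> differ, equal derivatives force \<open>p\<close>
  to divide every positive exponent of \<open>m\<close>. In degree \<open>p\<close> a single such
  exponent uses up the whole degree, so \<open>m\<close> would be an excluded pure power.\<close>

lemma mixed_partial_inject:
  fixes F G :: "'a::idom mpoly"
  assumes "CHAR('a) = p" "p > 0" "mixed n p F" "mixed n p G"
    and partial: "\<And>k. k \<in> {1..n} \<Longrightarrow> partial k F = partial k G"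
  shows "F = G"
proof (rule poly_mapping_eqI, rule ccontr)
  fix m
  assume ne: "Poly_Mapping.lookup F m \<noteq> Poly_Mapping.lookup G m"
  then have "m \<in> Poly_Mapping.keys F \<or> m \<in> Poly_Mapping.keys G" by (auto simp: in_keys_iff)
  then have sub: "Poly_Mapping.keys m \<subseteq> {1..n}"
    and deg: "(\<Sum>i\<in>Poly_Mapping.keys m. Poly_Mapping.lookup m i) = p"
    and pure: "\<And>i. i \<in> {1..n} \<Longrightarrow> m \<noteq> Poly_Mapping.single i p"
    using assms(3,4) unfolding mixed_iff by blast+
  from deg \<open>p > 0\<close> have "Poly_Mapping.keys m \<noteq> {}" by auto
  then obtain k where k: "k \<in> Poly_Mapping.keys m" by blast
  have le: "Poly_Mapping.lookup m k \<ge> p"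
  proof -
    \<comment> \<open>The coefficient of \<open>m\<close> is read off from the derivative at
      \<open>m\<close> divided by the variable \<open>k\<close>, where it appears with the factor
      \<open>Suc u\<close>.\<close>
    define u where "u = Poly_Mapping.lookup m k - 1"
    have u: "Poly_Mapping.lookup m k = Suc u" using k by (simp add: u_def in_keys_iff)
    have "m - Poly_Mapping.single k 1 + Poly_Mapping.single k 1 = m"
      using u by (intro poly_mapping_eqI) (auto simp: lookup_add lookup_minus lookup_single when_def)
    then have "Poly_Mapping.lookup (partial k H) (m - Poly_Mapping.single k 1) =
        of_nat (Suc u) * Poly_Mapping.lookup H m" for H :: "'a mpoly"
      using u by (simp add: lookup_partial lookup_minus)
    then have "of_nat (Suc u) * Poly_Mapping.lookup F m = of_nat (Suc u) * Poly_Mapping.lookup G m"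
      using partial[of k] k sub by (metis subsetD)
    with ne have "of_nat (Suc u) = (0::'a)" by (metis mult_left_cancel)
    then have "p dvd Poly_Mapping.lookup m k"
      unfolding of_nat_eq_0_iff_char_dvd assms(1) u .
    then show ?thesis using u by (auto dest: dvd_imp_le)
  qed
  have split: "p = Poly_Mapping.lookup m k +
      (\<Sum>i\<in>Poly_Mapping.keys m - {k}. Poly_Mapping.lookup m i)"
    using deg k by (simp add: sum.remove)
  have "m = Poly_Mapping.single k p"
  proof (rule poly_mapping_eqI)
    fix i
    show "Poly_Mapping.lookup m i = Poly_Mapping.lookup (Poly_Mapping.single k p) i"
    proof (cases "i = k")
      case False
      have "(\<Sum>i\<in>Poly_Mapping.keys m - {k}. Poly_Mapping.lookup m i) = 0" using split le by linarith
      with False show ?thesis by (auto simp: in_keys_iff lookup_single)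
    qed (use split le in simp)
  qed
  with pure[of k] k sub show False by blast
qed

text \<open>One equivalence delivers both existence and uniqueness of the next term.\<close>

lemma next_term_iff_eqI:
  fixes F :: "'a::idom mpoly"
  assumes "CHAR('a) = p" "p > 0" "mixed n p F" "\<And>k. k \<in> {1..n} \<Longrightarrow> partial k F = B n k H"
  shows "next_term p n H G \<longleftrightarrow> G = F"
proof
  assume "next_term p n H G"
  then have "mixed n p G" "\<And>k. k \<in> {1..n} \<Longrightarrow> partial k G = B n k H"
    unfolding next_term_def mixed_def by blast+
  with mixed_partial_inject[OF assms(1,2) _ assms(3), of G] assms(4) show "G = F" by simp
next
  assume "G = F"
  with assms(3,4) show "next_term p n H G" unfolding next_term_def mixed_def by blast
qed

subsection \<open>Sums over pairs, triples and compositions\<close>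

lemma sum_square_split:
  fixes g :: "'b::linorder \<Rightarrow> 'b \<Rightarrow> 'c::comm_monoid_add"
  assumes "finite A"
  shows "(\<Sum>i\<in>A. \<Sum>j\<in>A. g i j) =
    (\<Sum>(i, j)\<in>{(i, j). i \<in> A \<and> j \<in> A \<and> i < j}. g i j + g j i) + (\<Sum>i\<in>A. g i i)"
proof -
  let ?S = "\<lambda>R. {(i, j). i \<in> A \<and> j \<in> A \<and> R i j}"
  have fin: "finite (?S R)" for R
    by (rule finite_subset[of _ "A \<times> A"]) (use assms in auto)
  have "A \<times> A = ?S (<) \<union> ?S (\<lambda>i j. j < i) \<union> ?S (=)" by auto
  then have "(\<Sum>i\<in>A. \<Sum>j\<in>A. g i j) =
      (\<Sum>(i, j)\<in>?S (<) \<union> ?S (\<lambda>i j. j < i) \<union> ?S (=). g i j)"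
    by (simp add: sum.cartesian_product)
  also have "\<dots> = (\<Sum>(i, j)\<in>?S (<). g i j) + (\<Sum>(i, j)\<in>?S (\<lambda>i j. j < i). g i j)
      + (\<Sum>(i, j)\<in>?S (=). g i j)"
    by (subst sum.union_disjoint, auto simp: fin)+
  also have "(\<Sum>(i, j)\<in>?S (\<lambda>i j. j < i). g i j) = (\<Sum>(i, j)\<in>?S (<). g j i)"
    by (rule sum.reindex_bij_witness[of _ prod.swap prod.swap]) auto
  also have "(\<Sum>(i, j)\<in>?S (=). g i j) = (\<Sum>i\<in>A. g i i)"
    by (rule sum.reindex_bij_witness[of _ "\<lambda>i. (i, i)" fst]) auto
  finally show ?thesis by (simp add: sum.distrib case_prod_unfold)
qed

text \<open>Meant for summands differentiated in the variable \<open>k\<close>, which vanish unless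
  \<open>k\<close> is among the indices; symmetry then lets \<open>k\<close> come first whatever the
  order.\<close>

lemma sum_pairs_containing:
  fixes g :: "'b::linorder \<Rightarrow> 'b \<Rightarrow> 'c::comm_monoid_add"
  assumes "finite A" "k \<in> A"
    and sym: "\<And>i j. g i j = g j i"
    and supp: "\<And>i j. g i j \<noteq> 0 \<Longrightarrow> i = k \<or> j = k"
  shows "(\<Sum>(i, j)\<in>{(i, j). i \<in> A \<and> j \<in> A \<and> i < j}. g i j) = (\<Sum>j\<in>A - {k}. g k j)"
proof -
  let ?S = "{(i, j). i \<in> A \<and> j \<in> A \<and> i < j}"
  have "finite ?S" by (rule finite_subset[of _ "A \<times> A"]) (use assms in auto)
  then have "(\<Sum>(i, j)\<in>?S. g i j) = (\<Sum>(i, j)\<in>{(i, j)\<in>?S. i = k \<or> j = k}. g i j)"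
    by (intro sum.mono_neutral_right) (auto dest: supp)
  also have "\<dots> = (\<Sum>j\<in>A - {k}. g k j)"
    by (rule sum.reindex_bij_witness[of _ "\<lambda>j. if k < j then (k, j) else (j, k)"
          "\<lambda>(i, j). if i = k then j else i"]) (use \<open>k \<in> A\<close> sym in auto)
  finally show ?thesis .
qed

lemma sum_triples_containing:
  fixes g :: "'b::linorder \<Rightarrow> 'b \<Rightarrow> 'b \<Rightarrow> 'c::comm_monoid_add"
  assumes "finite A" "k \<in> A"
    and sym: "\<And>i j l. g i j l = g j i l" "\<And>i j l. g i j l = g i l j"
    and supp: "\<And>i j l. g i j l \<noteq> 0 \<Longrightarrow> i = k \<or> j = k \<or> l = k"
  shows "(\<Sum>(i, j, l)\<in>{(i, j, l). i \<in> A \<and> j \<in> A \<and> l \<in> A \<and> i < j \<and> j < l}. g i j l) =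
    (\<Sum>(i, j)\<in>{(i, j). i \<in> A - {k} \<and> j \<in> A - {k} \<and> i < j}. g k i j)"
proof -
  let ?S = "{(i, j, l). i \<in> A \<and> j \<in> A \<and> l \<in> A \<and> i < j \<and> j < l}"
  have "finite ?S" by (rule finite_subset[of _ "A \<times> A \<times> A"]) (use assms in auto)
  then have "(\<Sum>(i, j, l)\<in>?S. g i j l) =
      (\<Sum>(i, j, l)\<in>{(i, j, l)\<in>?S. i = k \<or> j = k \<or> l = k}. g i j l)"
    by (intro sum.mono_neutral_right) (auto dest: supp)
  also have "\<dots> = (\<Sum>(i, j)\<in>{(i, j). i \<in> A - {k} \<and> j \<in> A - {k} \<and> i < j}. g k i j)"
  \<comment> \<open>One witness inserts \<open>k\<close> at its sorted place in a pair, the other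
    deletes it from a triple.\<close>
  proof (rule sum.reindex_bij_witness[of _
        "\<lambda>(i, j). if k < i then (k, i, j) else if k < j then (i, k, j) else (i, j, k)"
        "\<lambda>(i, j, l). if i = k then (j, l) else if j = k then (i, l) else (i, j)"], goal_cases)
    case (5 x)
    obtain i j l where x: "x = (i, j, l)" by (cases x)
    have "g i k l = g k i l" "g i j k = g k i j"
      using sym(1)[of i k l] sym(2)[of i j k] sym(1)[of i k j] by simp_all
    then show ?case using 5 unfolding x by (auto simp only: split: if_splits)
  qed (use \<open>k \<in> A\<close> in \<open>auto split: if_splits\<close>)
  finally show ?thesis .
qed

section \<open>Compositions of an integer into two or three positive parts\<close>

definition parts2 :: "nat \<Rightarrow> (nat \<times> nat) set" where
  "parts2 p = {(r, s). r > 0 \<and> s > 0 \<and> r + s = p}"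

definition parts3 :: "nat \<Rightarrow> (nat \<times> nat \<times> nat) set" where
  "parts3 p = {(r, s, t). r > 0 \<and> s > 0 \<and> t > 0 \<and> r + s + t = p}"

lemma finite_parts2 [simp]: "finite (parts2 p)"
  by (rule finite_subset[of _ "{..p} \<times> {..p}"]) (auto simp: parts2_def)

lemma sum_parts2_swap: "(\<Sum>(r, s)\<in>parts2 p. f r s) = (\<Sum>(r, s)\<in>parts2 p. f s r)"
  by (rule sum.reindex_bij_witness[of _ prod.swap prod.swap]) (auto simp: parts2_def)

lemma sum_parts3_swap12: "(\<Sum>(r, s, t)\<in>parts3 p. f r s t) = (\<Sum>(r, s, t)\<in>parts3 p. f s r t)"
  by (rule sum.reindex_bij_witness[of _ "\<lambda>(r, s, t). (s, r, t)" "\<lambda>(r, s, t). (s, r, t)"])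
    (auto simp: parts3_def)

lemma sum_parts3_swap23: "(\<Sum>(r, s, t)\<in>parts3 p. f r s t) = (\<Sum>(r, s, t)\<in>parts3 p. f r t s)"
  by (rule sum.reindex_bij_witness[of _ "\<lambda>(r, s, t). (r, t, s)" "\<lambda>(r, s, t). (r, t, s)"])
    (auto simp: parts3_def)

text \<open>Merging \<open>t\<close> into \<open>r\<close> maps triples to pairs; the fibre over a
  pair is parametrised by the absorbed part \<open>d = t\<close>, which leaves a positive rest
  exactly for \<open>d\<close> up to \<open>r - 1\<close>.\<close>

lemma sum_parts3_merge13:
  "(\<Sum>(r, s, t)\<in>parts3 p. f (r + t) s t) = (\<Sum>(r, s)\<in>parts2 p. \<Sum>d = 1..r - 1. f r s d)"
proof -
  have "(\<Sum>(r, s)\<in>parts2 p. \<Sum>d = 1..r - 1. f r s d) =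
      (\<Sum>((r, s), d)\<in>(SIGMA (r, s):parts2 p. {1..r - 1}). f r s d)"
    by (subst sum.Sigma[symmetric]) (auto simp: case_prod_unfold)
  also have "\<dots> = (\<Sum>(r, s, t)\<in>parts3 p. f (r + t) s t)"
    by (rule sum.reindex_bij_witness[of _ "\<lambda>(r, s, t). ((r + t, s), t)" "\<lambda>((r, s), d). (r - d, s, d)"])
      (auto simp: parts2_def parts3_def)
  finally show ?thesis by (rule sym)
qed

lemma sum_parts3_merge23:
  "(\<Sum>(r, s, t)\<in>parts3 p. f r (s + t) t) = (\<Sum>(r, s)\<in>parts2 p. \<Sum>d = 1..s - 1. f r s d)"
  using sum_parts3_merge13[of "\<lambda>r s d. f s r d" p]
  by (subst sum_parts3_swap12, subst sum_parts2_swap) simp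

subsection \<open>The first two steps of the recursion\<close>

text \<open>
  The form \<open>L\<close>, the quotient \<open>(L(x\<^sub>k, x\<^sub>i) - L(x\<^sub>j, x\<^sub>i)) / (x\<^sub>k - x\<^sub>j)\<close>, its \<open>j\<close>-free part, and minus
  the remaining part, where \<open>1 / t\<close> stems from \<open>1 / (r + s) = - 1 / t\<close>.
\<close>

definition log_form :: "nat \<Rightarrow> nat \<Rightarrow> nat \<Rightarrow> 'a::field mpoly" where
  "log_form p i j = (\<Sum>(r, s)\<in>parts2 p. cst (1 / of_nat r) * var i ^ r * var j ^ s)"

definition log_quot :: "nat \<Rightarrow> nat \<Rightarrow> nat \<Rightarrow> nat \<Rightarrow> 'a::field mpoly" where
  "log_quot p k j i = (\<Sum>(r, s)\<in>parts2 p.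
    cst (1 / of_nat r) * (\<Sum>u<r. var j ^ (r - Suc u) * var k ^ u) * var i ^ s)"

definition log_lead :: "nat \<Rightarrow> nat \<Rightarrow> nat \<Rightarrow> 'a::field mpoly" where
  "log_lead p k i = (\<Sum>(r, s)\<in>parts2 p. cst (1 / of_nat r) * var k ^ (r - 1) * var i ^ s)"

definition log_tail :: "nat \<Rightarrow> nat \<Rightarrow> nat \<Rightarrow> nat \<Rightarrow> 'a::field mpoly" where
  "log_tail p k j i = (\<Sum>(r, s, t)\<in>parts3 p.
    cst (1 / of_nat t) * var k ^ (r - 1) * var j ^ s * var i ^ t)"

text \<open>Termwise this is the factorisation of a difference of two \<open>r\<close>-th
  powers.\<close>

lemma diff_mult_log_quot:
  "(var k - var j) * log_quot p k j i = log_form p k i - log_form p j i"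
proof -
  have "(var k - var j) * (c * (\<Sum>u<r. var j ^ (r - Suc u) * var k ^ u) * z) =
      c * var k ^ r * z - c * var j ^ r * z" for c z :: "'a mpoly" and r
  proof -
    have "(var k - var j) * (c * (\<Sum>u<r. var j ^ (r - Suc u) * var k ^ u) * z) =
        c * ((var k - var j) * (\<Sum>u<r. var j ^ (r - Suc u) * var k ^ u)) * z"
      by (simp only: ac_simps)
    also have "\<dots> = c * (var k ^ r - var j ^ r) * z"
      by (simp only: power_diff_sumr2)
    finally show ?thesis by (simp add: algebra_simps)
  qed
  then show ?thesis
    unfolding log_quot_def log_form_def sum_distrib_left sum_subtractf[symmetric]
    by (simp only: case_prod_unfold)
qed

lemma swap_log_form: "swap k j (log_form p i l) = log_form p (transpose k j i) (transpose k j l)"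
  unfolding log_form_def by (simp add: swap_sum swap_mult case_prod_unfold)

lemma partial_monom2:
  "i \<noteq> k \<Longrightarrow> partial k (cst c * var k ^ r * var i ^ s) =
    cst (of_nat r * c) * var k ^ (r - 1) * var i ^ s"
  by (simp add: partial_mult partial_var_power cst_mult mult_ac)

lemma partial_monom3:
  "i \<noteq> k \<Longrightarrow> j \<noteq> k \<Longrightarrow> partial k (cst c * var k ^ r * var j ^ s * var i ^ t) =
    cst (of_nat r * c) * var k ^ (r - 1) * var j ^ s * var i ^ t"
  by (simp add: partial_mult partial_var_power cst_mult mult_ac)

section \<open>The second term, split by the set of indices involved\<close>

definition F2_triple :: "nat \<Rightarrow> (nat \<Rightarrow> 'a::field) \<Rightarrow> nat \<Rightarrow> nat \<Rightarrow> nat \<Rightarrow> 'a mpoly" where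
  "F2_triple p a i j k = (\<Sum>(r, s, t)\<in>parts3 p.
    cst ((of_nat r * a i + of_nat s * a j + of_nat t * a k) / (of_nat r * of_nat s * of_nat t))
      * var i ^ r * var j ^ s * var k ^ t)"

definition F2_pair :: "nat \<Rightarrow> (nat \<Rightarrow> 'a::field) \<Rightarrow> nat \<Rightarrow> nat \<Rightarrow> 'a mpoly" where
  "F2_pair p a i j = (\<Sum>(r, s)\<in>parts2 p.
    cst ((a i - a j) / of_nat r * (1 / of_nat s - 2 * (\<Sum>d = 1..s. 1 / of_nat d)))
      * var i ^ r * var j ^ s)"

lemma F2_eq:
  "F2 p n a = (\<Sum>(i, j, k)\<in>{(i, j, k). i \<in> {1..n} \<and> j \<in> {1..n} \<and> k \<in> {1..n} \<and> i < j \<and> j < k}.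
      F2_triple p a i j k)
    + (\<Sum>(i, j)\<in>{(i, j). i \<in> {1..n} \<and> j \<in> {1..n} \<and> i < j}. F2_pair p a i j)"
proof -
  have "{(i, j, k). 1 \<le> i \<and> i < j \<and> j < k \<and> k \<le> n} =
      {(i, j, k). i \<in> {1..n} \<and> j \<in> {1..n} \<and> k \<in> {1..n} \<and> i < j \<and> j < k}"
    and "{(i, j). 1 \<le> i \<and> i < j \<and> j \<le> n} = {(i, j). i \<in> {1..n} \<and> j \<in> {1..n} \<and> i < j}"
    by auto
  then show ?thesis
    unfolding F2_def F2_triple_def F2_pair_def parts2_def parts3_def by (simp only:)
qed

lemma F2_triple_sym12: "F2_triple p a i j k = F2_triple p a j i k"
  unfolding F2_triple_def by (subst sum_parts3_swap12) (simp add: ac_simps)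

lemma F2_triple_sym23: "F2_triple p a i j k = F2_triple p a i k j"
  unfolding F2_triple_def by (subst sum_parts3_swap23) (simp add: ac_simps)

lemma mixed_F2: "mixed n p (F2 p n a)"
  unfolding F2_eq F2_triple_def F2_pair_def
  by (intro mixed_add mixed_sum)
    (auto simp: parts2_def parts3_def intro!: mixed_sum mixed_monom2 mixed_monom3)

section \<open>Arithmetic and harmonic sums in characteristic \<open>p\<close>\<close>

definition harm :: "nat \<Rightarrow> 'a::field" where
  "harm m = (\<Sum>d = 1..m. 1 / of_nat d)"

lemma harm_pred: "s > 0 \<Longrightarrow> harm (s - 1) = harm s - 1 / of_nat s"
  by (cases s) (simp_all add: harm_def)

context
  fixes p :: nat
  assumes char: "CHAR('a::field) = p" and p_gt_2: "p > 2"
begin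

lemma of_nat_neq_0: "0 < r \<Longrightarrow> r < p \<Longrightarrow> of_nat r \<noteq> (0::'a)"
  using char by (auto simp: of_nat_eq_0_iff_char_dvd dest: dvd_imp_le)

lemma of_nat_eq_uminus: "r + s = p \<Longrightarrow> of_nat r = - (of_nat s :: 'a)"
  using of_nat_CHAR[where ?'a = 'a] unfolding char by (auto simp: eq_neg_iff_add_eq_0)

lemma two_neq_0: "(2::'a) \<noteq> 0"
  using of_nat_neq_0[of 2] p_gt_2 by simp

text \<open>The reflection of \<open>d\<close> to \<open>p - d\<close> negates \<open>1 / d\<close>,
  so the upper part of \<open>harm (p - 1)\<close>, from \<open>r\<close> on, equals
  \<open>- harm s\<close>.\<close>

lemma harm_split:
  assumes rs: "r + s = p" "r > 0"
  shows "harm (r - 1) = (harm s + harm (p - 1) :: 'a)"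
proof -
  have neg: "- (1 / of_nat (p - d)) = (1 / of_nat d :: 'a)" if "d < p" for d
    using of_nat_eq_uminus[of "p - d" d] that by simp
  from rs have "{1..p - 1} = {1..r - 1} \<union> {r..p - 1}" by auto
  then have "harm (p - 1) = (harm (r - 1) + (\<Sum>d = r..p - 1. 1 / of_nat d) :: 'a)"
    unfolding harm_def by (simp add: sum.union_disjoint)
  moreover have "(\<Sum>d = r..p - 1. 1 / of_nat d :: 'a) = (\<Sum>d = 1..s. - (1 / of_nat d))"
    by (rule sum.reindex_bij_witness[of _ "\<lambda>d. p - d" "\<lambda>d. p - d"])
      (use rs neg in auto)
  ultimately show ?thesis by (simp add: harm_def sum_negf)
qed

lemma harm_reflect:
  assumes "r + s = p" "r > 0"
  shows "harm (r - 1) = (harm s :: 'a)"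
proof -
  \<comment> \<open>The extreme case \<open>r = 1\<close> shows that twice the full harmonic sum is
    zero; \<open>p\<close> being odd, the sum itself vanishes.\<close>
  have "harm 0 = (harm (p - 1) + harm (p - 1) :: 'a)"
    using harm_split[of 1 "p - 1"] p_gt_2 by simp
  then have "2 * harm (p - 1) = (0 :: 'a)" unfolding mult_2 by (simp add: harm_def)
  then show ?thesis using two_neq_0 harm_split[OF assms] by simp
qed

lemma parts2_of_nat:
  assumes "(r, s) \<in> parts2 p"
  shows "(of_nat r :: 'a) \<noteq> 0" "(of_nat s :: 'a) \<noteq> 0" "(of_nat r :: 'a) = - of_nat s"
  using assms of_nat_neq_0 of_nat_eq_uminus
  by (auto simp: parts2_def)

lemma parts3_of_nat:
  assumes "(r, s, t) \<in> parts3 p"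
  shows "(of_nat r :: 'a) \<noteq> 0" "(of_nat s :: 'a) \<noteq> 0" "(of_nat t :: 'a) \<noteq> 0"
    "(of_nat r :: 'a) = - of_nat s - of_nat t"
proof -
  have "(of_nat r :: 'a) = - of_nat (s + t)"
    by (rule of_nat_eq_uminus) (use assms in \<open>simp add: parts3_def\<close>)
  then show "(of_nat r :: 'a) = - of_nat s - of_nat t" by simp
qed (use assms of_nat_neq_0 in \<open>auto simp: parts3_def\<close>)

section \<open>The antisymmetric form and the first step\<close>

lemma log_form_antisym: "log_form p j i = - (log_form p i j :: 'a mpoly)"
proof -
  have "log_form p j i = (\<Sum>(r, s)\<in>parts2 p. cst (1 / of_nat s) * var j ^ s * var i ^ r :: 'a mpoly)"
    unfolding log_form_def by (rule sum_parts2_swap)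
  also have "\<dots> = (\<Sum>(r, s)\<in>parts2 p. - (cst (1 / of_nat r) * var i ^ r * var j ^ s))"
    by (rule sum.cong) (auto simp: parts2_of_nat(3) cst_uminus mult_ac)
  finally show ?thesis
    by (simp add: log_form_def sum_negf case_prod_unfold)
qed

lemma log_form_diag: "log_form p i i = (0 :: 'a mpoly)"
proof -
  \<comment> \<open>Antisymmetry gives only that twice the form is zero; the factor 2 is cancelled
    in the coefficient field.\<close>
  have "2 * Poly_Mapping.lookup (log_form p i i :: 'a mpoly) m = 0" for m
    using arg_cong[OF log_form_antisym[of i i], of "\<lambda>f. Poly_Mapping.lookup f m"]
    unfolding lookup_uminus eq_neg_iff_add_eq_0 mult_2 .
  then show ?thesis
    using two_neq_0 by (intro poly_mapping_eqI) simp
qed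

lemma F1_eq:
  "F1 p n a = (\<Sum>(i, j)\<in>{(i, j). i \<in> {1..n} \<and> j \<in> {1..n} \<and> i < j}.
    cst (a i - a j :: 'a) * log_form p i j)"
proof -
  \<comment> \<open>Substituting \<open>r = - s\<close> makes the numerator a multiple of
    \<open>a i - a j\<close> and cancels one denominator.\<close>
  have scalar: "- ((of_nat r * a i + of_nat s * a j) / (of_nat r * of_nat s)) =
      (a i - a j) * (1 / of_nat r)" if "(r, s) \<in> parts2 p" for i j r s
    using parts2_of_nat[OF that] by (simp add: field_simps)
  have monom: "- (cst ((of_nat r * a i + of_nat s * a j) / (of_nat r * of_nat s))
        * var i ^ r * var j ^ s) =
      cst (a i - a j) * (cst (1 / of_nat r) * var i ^ r * var j ^ s)"
    if "(r, s) \<in> parts2 p" for i j r s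
    unfolding mult_minus_left[symmetric] cst_uminus[symmetric] scalar[OF that] cst_mult mult.assoc ..
  have pair: "- (\<Sum>(r, s)\<in>parts2 p.
      cst ((of_nat r * a i + of_nat s * a j) / (of_nat r * of_nat s)) * var i ^ r * var j ^ s) =
      cst (a i - a j) * log_form p i j" for i j
    unfolding log_form_def sum_distrib_left sum_negf[symmetric]
    by (rule sum.cong) (use monom in auto)
  have "{(i, j). 1 \<le> i \<and> i < j \<and> j \<le> n} = {(i, j). i \<in> {1..n} \<and> j \<in> {1..n} \<and> i < j}"
    by auto
  then have "F1 p n a = - (\<Sum>(i, j)\<in>{(i, j). i \<in> {1..n} \<and> j \<in> {1..n} \<and> i < j}.
      \<Sum>(r, s)\<in>parts2 p.
        cst ((of_nat r * a i + of_nat s * a j) / (of_nat r * of_nat s)) * var i ^ r * var j ^ s)"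
    unfolding F1_def parts2_def by (simp only:)
  also have "\<dots> = (\<Sum>(i, j)\<in>{(i, j). i \<in> {1..n} \<and> j \<in> {1..n} \<and> i < j}.
      cst (a i - a j :: 'a) * log_form p i j)"
    unfolding sum_negf[symmetric] by (rule sum.cong) (auto simp: pair)
  finally show ?thesis .
qed

text \<open>This is the shape required by \<open>div_diff_equivariant_family\<close>: the diagonal
  vanishes, and antisymmetry joins the two orders of a pair into the factor
  \<open>a i - a j\<close>.\<close>

lemma F1_eq_family:
  "F1 p n a = (\<Sum>i\<in>{1..n}. cst (a i :: 'a) * (\<Sum>l\<in>{1..n}. log_form p i l))"
proof -
  have "(\<Sum>i\<in>{1..n}. cst (a i :: 'a) * (\<Sum>l\<in>{1..n}. log_form p i l)) =
      (\<Sum>(i, j)\<in>{(i, j). i \<in> {1..n} \<and> j \<in> {1..n} \<and> i < j}.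
        cst (a i) * log_form p i j + cst (a j) * log_form p j i)"
    unfolding sum_distrib_left by (subst sum_square_split) (simp_all add: log_form_diag)
  also have "\<dots> = F1 p n a"
    unfolding F1_eq
  proof (rule sum.cong[OF refl], clarify)
    show "cst (a i) * log_form p i j + cst (a j) * log_form p j i =
        cst (a i - a j) * log_form p i j" for i j
      unfolding log_form_antisym[of j i] by (simp add: cst_diff algebra_simps)
  qed
  finally show ?thesis by simp
qed

lemma mixed_F1: "mixed n p (F1 p n (a :: nat \<Rightarrow> 'a))"
  unfolding F1_def by (intro mixed_uminus mixed_sum) (auto intro!: mixed_sum mixed_monom2)

lemma partial_F1:
  assumes "k \<in> {1..n}"
  shows "partial k (F1 p n a) =
    (\<Sum>j\<in>{1..n} - {k}. cst (a k - a j :: 'a) *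
      (\<Sum>(r, s)\<in>parts2 p. var k ^ (r - 1) * var j ^ s))"
proof -
  let ?T = "\<lambda>i j. partial k (cst (a i - a j) * log_form p i j)"
  have "partial k (F1 p n a) = (\<Sum>(i, j)\<in>{(i, j). i \<in> {1..n} \<and> j \<in> {1..n} \<and> i < j}. ?T i j)"
    unfolding F1_eq by (simp add: partial_sum case_prod_unfold)
  also have "\<dots> = (\<Sum>j\<in>{1..n} - {k}. ?T k j)"
  proof (rule sum_pairs_containing)
    \<comment> \<open>Both factors change sign when \<open>i\<close> and \<open>j\<close> are
      exchanged.\<close>
    show "?T i j = ?T j i" for i j
      using log_form_antisym[of i j] by (simp add: cst_diff algebra_simps)
    show "i = k \<or> j = k" if "?T i j \<noteq> 0" for i j
    proof (rule ccontr)
      assume "\<not> (i = k \<or> j = k)"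
      then have "?T i j = 0"
        by (simp add: log_form_def partial_mult partial_sum partial_var_power case_prod_unfold)
      with that show False ..
    qed
  qed (use assms in auto)
  also have "\<dots> = (\<Sum>j\<in>{1..n} - {k}. cst (a k - a j) *
      (\<Sum>(r, s)\<in>parts2 p. var k ^ (r - 1) * var j ^ s))"
  proof (rule sum.cong[OF refl])
    fix j assume j: "j \<in> {1..n} - {k}"
    have "partial k (log_form p k j) = (\<Sum>(r, s)\<in>parts2 p. var k ^ (r - 1) * var j ^ s :: 'a mpoly)"
      unfolding log_form_def partial_sum
      by (rule sum.cong) (use j in \<open>auto simp: partial_monom2 parts2_of_nat(1,2)\<close>)
    then show "?T k j = cst (a k - a j) * (\<Sum>(r, s)\<in>parts2 p. var k ^ (r - 1) * var j ^ s)"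
      by (simp add: partial_mult)
  qed
  finally show ?thesis .
qed

text \<open>Here \<open>p dvd n\<close> and the vanishing of the sum of the \<open>a i\<close> take
  effect: they eliminate whatever part of a divided difference is independent of
  \<open>j\<close>.\<close>

lemma sum_differences_eq_0:
  assumes "p dvd n" "(\<Sum>i\<in>{1..n}. a i) = 0" "k \<in> {1..n}"
  shows "(\<Sum>j\<in>{1..n} - {k}. a k - a j :: 'a) = 0"
proof -
  have "(\<Sum>j\<in>{1..n} - {k}. a k - a j) = (\<Sum>j\<in>{1..n}. a k - a j)"
    using assms(3) by (subst (2) sum.remove[of _ k]) auto
  also have "\<dots> = of_nat n * a k" using assms(2) by (simp add: sum_subtractf)
  also have "(of_nat n :: 'a) = 0" using assms(1) char by (simp add: of_nat_eq_0_iff_char_dvd)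
  finally show ?thesis by simp
qed

lemma B_F0:
  assumes n: "p dvd n" and a: "(\<Sum>i\<in>{1..n}. a i) = 0" and k: "k \<in> {1..n}"
  shows "B n k (F0 p n a) =
    (\<Sum>j\<in>{1..n} - {k}. cst (a k - a j :: 'a) *
      (\<Sum>(r, s)\<in>parts2 p. var k ^ (r - 1) * var j ^ s))"
proof -
  have "div_diff k j (F0 p n a) = cst (a k - a j) *
      (var k ^ (p - 1) + (\<Sum>(r, s)\<in>parts2 p. var k ^ (r - 1) * var j ^ s))"
    if j: "j \<in> {1..n} - {k}" for j
    unfolding F0_def
  proof (rule div_diff_equivariant_family)
    \<comment> \<open>The last summand, \<open>i = p - 1\<close>, is the only one free of the
      variable \<open>j\<close>.\<close>
    have "(\<Sum>i<p. var j ^ (p - Suc i) * var k ^ i :: 'a mpoly) =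
        var k ^ (p - 1) + (\<Sum>i<p - 1. var j ^ (p - Suc i) * var k ^ i)"
      using p_gt_2 by (subst Suc_diff_1[of p, symmetric]) (simp_all only: sum.lessThan_Suc, simp_all)
    also have "(\<Sum>i<p - 1. var j ^ (p - Suc i) * var k ^ i :: 'a mpoly) =
        (\<Sum>(r, s)\<in>parts2 p. var k ^ (r - 1) * var j ^ s)"
      by (rule sum.reindex_bij_witness[of _ "\<lambda>(r, s). r - 1" "\<lambda>i. (Suc i, p - Suc i)"])
        (auto simp: parts2_def)
    finally show "(var k - var j) * (var k ^ (p - 1) +
        (\<Sum>(r, s)\<in>parts2 p. var k ^ (r - 1) * var j ^ s)) = var k ^ p - (var j ^ p :: 'a mpoly)"
      by (simp only: power_diff_sumr2)
  qed (use j k in auto)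
  then have "B n k (F0 p n a) = cst (\<Sum>j\<in>{1..n} - {k}. a k - a j) * var k ^ (p - 1) +
      (\<Sum>j\<in>{1..n} - {k}. cst (a k - a j) * (\<Sum>(r, s)\<in>parts2 p. var k ^ (r - 1) * var j ^ s))"
    unfolding B_def by (simp add: cst_sum sum_distrib_right sum.distrib distrib_left)
  then show ?thesis using sum_differences_eq_0[OF n a k] by simp
qed

section \<open>The second step: quotient, symmetry and derivative\<close>

lemma log_quot_eq: "log_quot p k j i = log_lead p k i - (log_tail p k j i :: 'a mpoly)"
proof -
  \<comment> \<open>Again the last summand of the geometric sum is the one without the variable
    \<open>j\<close>; it makes up \<open>log_lead\<close>.\<close>
  have "(\<Sum>u<r. var j ^ (r - Suc u) * var k ^ u :: 'a mpoly) =
      var k ^ (r - 1) + (\<Sum>u<r - 1. var j ^ (r - Suc u) * var k ^ u)" if "r > 0" for r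
    using that by (cases r) simp_all
  then have "log_quot p k j i = log_lead p k i + (\<Sum>(r, s)\<in>parts2 p. \<Sum>u<r - 1.
      cst (1 / of_nat r) * (var j ^ (r - Suc u) * var k ^ u) * var i ^ s :: 'a mpoly)"
    unfolding log_quot_def log_lead_def sum.distrib[symmetric]
    by (intro sum.cong refl)
      (auto simp: parts2_def distrib_left distrib_right
        simp flip: sum_distrib_left sum_distrib_right)
  also have "(\<Sum>(r, s)\<in>parts2 p. \<Sum>u<r - 1.
      cst (1 / of_nat r) * (var j ^ (r - Suc u) * var k ^ u) * var i ^ s :: 'a mpoly) =
      (\<Sum>((r, s), u)\<in>(SIGMA (r, s):parts2 p. {..<r - 1}).
        cst (1 / of_nat r) * (var j ^ (r - Suc u) * var k ^ u) * var i ^ s)"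
    by (subst sum.Sigma[symmetric]) (auto simp: case_prod_unfold)
  also have "\<dots> = (\<Sum>(r, s, t)\<in>parts3 p.
      - (cst (1 / of_nat t) * var k ^ (r - 1) * var j ^ s * var i ^ t))"
  \<comment> \<open>The new parts are \<open>Suc u\<close>, \<open>r - Suc u\<close> and the old
    \<open>s\<close>. The first exceeds the exponent of the variable \<open>k\<close> by one, so
    that the parts sum to \<open>p\<close>; the sign comes from the old \<open>r\<close> being
    \<open>- s\<close> in the field.\<close>
  proof (rule sum.reindex_bij_witness[of _ "\<lambda>(r, s, t). ((r + s, t), r - 1)"
        "\<lambda>((r, s), u). (Suc u, r - Suc u, s)"], goal_cases)
    case (5 x)
    obtain r s u where x: "x = ((r, s), u)" by (metis prod.exhaust)
    with 5 have "(r, s) \<in> parts2 p" by auto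
    then show ?case unfolding x by (simp add: parts2_of_nat(3) cst_uminus mult_ac)
  qed (auto simp: parts2_def parts3_def)
  also have "\<dots> = - log_tail p k j i"
    unfolding log_tail_def by (simp add: sum_negf case_prod_unfold)
  finally show ?thesis by simp
qed

lemma B_F1:
  assumes n: "p dvd n" and a: "(\<Sum>i\<in>{1..n}. a i) = 0" and k: "k \<in> {1..n}"
  shows "B n k (F1 p n a) =
    - (\<Sum>j\<in>{1..n} - {k}. \<Sum>i\<in>{1..n}. cst (a k - a j :: 'a) * log_tail p k j i)"
proof -
  have "div_diff k j (F1 p n a) = cst (a k - a j) * (\<Sum>i\<in>{1..n}. log_quot p k j i)"
    if j: "j \<in> {1..n} - {k}" for j
    unfolding F1_eq_family
  proof (rule div_diff_equivariant_family)
    \<comment> \<open>The transposition also permutes the inner index \<open>l\<close>, so applying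
      it to \<open>P i\<close> only changes \<open>i\<close>.\<close>
    have bij: "bij_betw (transpose k j) {1..n} {1..n}"
      using j k by (intro bij_betw_byWitness[of _ "transpose k j"]) (auto simp: transpose_def)
    show "swap k j (\<Sum>l\<in>{1..n}. log_form p i l :: 'a mpoly) =
        (\<Sum>l\<in>{1..n}. log_form p (transpose k j i) l)" for i
      unfolding swap_sum swap_log_form by (rule sum.reindex_bij_betw[OF bij])
    show "(var k - var j) * (\<Sum>i\<in>{1..n}. log_quot p k j i) =
        (\<Sum>l\<in>{1..n}. log_form p k l) - (\<Sum>l\<in>{1..n}. log_form p j l :: 'a mpoly)"
      by (simp add: sum_distrib_left diff_mult_log_quot sum_subtractf)
  qed (use j k in auto)
  then have "B n k (F1 p n a) =
      (\<Sum>j\<in>{1..n} - {k}. cst (a k - a j)) * (\<Sum>i\<in>{1..n}. log_lead p k i)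
      - (\<Sum>j\<in>{1..n} - {k}. \<Sum>i\<in>{1..n}. cst (a k - a j) * log_tail p k j i)"
    unfolding B_def
    by (simp add: log_quot_eq sum_subtractf right_diff_distrib flip: sum_distrib_left sum_distrib_right)
  then show ?thesis
    using sum_differences_eq_0[OF n a k] by (simp add: cst_sum[symmetric])
qed

text \<open>The formula hides its symmetry: \<open>harm r = harm s - 1 / s\<close> together with
  \<open>r = - s\<close> makes the bracket invariant under exchanging \<open>r\<close> and
  \<open>s\<close>, and \<open>(a i - a j) / r\<close> equals
  \<open>(a j - a i) / s\<close>.\<close>

lemma F2_pair_sym: "F2_pair p a i j = (F2_pair p a j i :: 'a mpoly)"
proof -
  have scalar: "(a j - a i) / of_nat s * (1 / of_nat r - 2 * (\<Sum>d = 1..r. 1 / of_nat d)) =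
      (a i - a j) / of_nat r * (1 / of_nat s - 2 * (\<Sum>d = 1..s. 1 / of_nat d))"
    if rs: "(r, s) \<in> parts2 p" for r s
  proof -
    have h: "harm r = harm s - 1 / (of_nat s :: 'a)"
      using rs harm_reflect[of s r] harm_pred[of s, where ?'a = 'a]
      by (simp add: parts2_def)
    show ?thesis
      unfolding harm_def[symmetric] h parts2_of_nat(3)[OF rs]
      using parts2_of_nat(2)[OF rs] by (simp add: field_simps)
  qed
  have "F2_pair p a j i = (\<Sum>(r, s)\<in>parts2 p.
      cst ((a j - a i) / of_nat s * (1 / of_nat r - 2 * (\<Sum>d = 1..r. 1 / of_nat d)))
        * var j ^ s * var i ^ r)"
    unfolding F2_pair_def by (rule sum_parts2_swap)
  also have "\<dots> = F2_pair p a i j"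
    unfolding F2_pair_def by (rule sum.cong[OF refl], clarify, simp only: scalar mult_ac)
  finally show ?thesis by simp
qed

text \<open>An unordered pair of further indices arises twice in the double sum for
  \<open>B n k (F1 p n a)\<close>, since either index can be the one of the divided difference. With
  \<open>r = - s - t\<close>, the two coefficients add up to that of the triple.\<close>

lemma partial_F2_triple:
  assumes "i \<noteq> k" "j \<noteq> k"
  shows "partial k (F2_triple p a k j i) =
    - (cst (a k - a j :: 'a) * log_tail p k j i + cst (a k - a i) * log_tail p k i j)"
proof -
  have swapped: "log_tail p k i j =
      (\<Sum>(r, s, t)\<in>parts3 p. cst (1 / of_nat s) * var k ^ (r - 1) * var j ^ s * var i ^ t :: 'a mpoly)"
    unfolding log_tail_def by (subst sum_parts3_swap23) (simp only: mult_ac)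
  have "- (cst (a k - a j) * log_tail p k j i + cst (a k - a i) * log_tail p k i j) =
      (\<Sum>(r, s, t)\<in>parts3 p. cst (- ((a k - a j) * (1 / of_nat t) + (a k - a i) * (1 / of_nat s)))
        * var k ^ (r - 1) * var j ^ s * var i ^ t)"
    unfolding log_tail_def[of p k j i] swapped sum_distrib_left sum.distrib[symmetric] sum_negf[symmetric]
      cst_uminus cst_add cst_mult
    by (auto intro!: sum.cong simp: algebra_simps)
  also have "\<dots> = partial k (F2_triple p a k j i)"
    unfolding F2_triple_def partial_sum
  proof (rule sum.cong[OF refl], clarify)
    fix r s t assume "(r, s, t) \<in> parts3 p"
    from parts3_of_nat[OF this]
    have "- ((a k - a j) * (1 / of_nat t) + (a k - a i) * (1 / of_nat s)) = of_nat r *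
        ((of_nat r * a k + of_nat s * a j + of_nat t * a i) / (of_nat r * of_nat s * of_nat t))"
      by (simp add: divide_simps) (simp add: algebra_simps)
    then show "cst (- ((a k - a j) * (1 / of_nat t) + (a k - a i) * (1 / of_nat s)))
        * var k ^ (r - 1) * var j ^ s * var i ^ t =
      partial k (cst ((of_nat r * a k + of_nat s * a j + of_nat t * a i)
        / (of_nat r * of_nat s * of_nat t)) * var k ^ r * var j ^ s * var i ^ t)"
      by (simp only: partial_monom3[OF assms])
  qed
  finally show ?thesis by simp
qed

text \<open>When the third variable coincides with the first, their powers merge, and summing
  \<open>1 / t\<close> over all ways to split the merged exponent produces a harmonic sum.\<close>

lemma log_tail_diag1:
  "log_tail p k j k =
    (\<Sum>(r, s)\<in>parts2 p. cst (harm (r - 1) :: 'a) * var k ^ (r - 1) * var j ^ s)"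
proof -
  have "log_tail p k j k =
      (\<Sum>(r, s, t)\<in>parts3 p. cst (1 / of_nat t) * var k ^ (r + t - 1) * var j ^ s :: 'a mpoly)"
    unfolding log_tail_def
  proof (rule sum.cong[OF refl], clarify)
    fix r s t assume "(r, s, t) \<in> parts3 p"
    \<comment> \<open>Truncated subtraction is harmless because \<open>r\<close> is
      positive.\<close>
    then have "r + t - 1 = (r - 1) + t" by (simp add: parts3_def)
    then show "cst (1 / of_nat t) * var k ^ (r - 1) * var j ^ s * var k ^ t =
        cst (1 / of_nat t) * var k ^ (r + t - 1) * (var j ^ s :: 'a mpoly)"
      by (simp only: power_add mult_ac)
  qed
  also have "\<dots> = (\<Sum>(r, s)\<in>parts2 p. \<Sum>d = 1..r - 1.
      cst (1 / of_nat d) * var k ^ (r - 1) * var j ^ s)"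
    by (rule sum_parts3_merge13)
  finally show ?thesis
    by (simp add: harm_def cst_sum sum_distrib_right)
qed

lemma log_tail_diag2:
  "log_tail p k j j =
    (\<Sum>(r, s)\<in>parts2 p. cst (harm (s - 1) :: 'a) * var k ^ (r - 1) * var j ^ s)"
proof -
  have "log_tail p k j j =
      (\<Sum>(r, s, t)\<in>parts3 p. cst (1 / of_nat t) * var k ^ (r - 1) * var j ^ (s + t) :: 'a mpoly)"
    unfolding log_tail_def by (simp only: power_add mult.assoc)
  also have "\<dots> = (\<Sum>(r, s)\<in>parts2 p. \<Sum>d = 1..s - 1.
      cst (1 / of_nat d) * var k ^ (r - 1) * var j ^ s)"
    by (rule sum_parts3_merge23)
  finally show ?thesis
    by (simp add: harm_def cst_sum sum_distrib_right)
qed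

text \<open>The two coincidences contribute \<open>harm (s - 1) + harm (r - 1)\<close>. By
  reflection this is \<open>2 * harm s - 1 / s\<close>, the negated bracket of
  \<open>F2_pair\<close>.\<close>

lemma partial_F2_pair:
  assumes "j \<noteq> k"
  shows "partial k (F2_pair p a k j) =
    - (cst (a k - a j :: 'a) * (log_tail p k j j + log_tail p k j k))"
proof -
  have "- (cst (a k - a j) * (log_tail p k j j + log_tail p k j k)) =
      (\<Sum>(r, s)\<in>parts2 p. cst (- ((a k - a j) * (harm (s - 1) + harm (r - 1))))
        * var k ^ (r - 1) * var j ^ s)"
    unfolding log_tail_diag1 log_tail_diag2 sum.distrib[symmetric] sum_distrib_left sum_negf[symmetric]
      cst_uminus cst_add cst_mult
    by (auto intro!: sum.cong simp: algebra_simps)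
  also have "\<dots> = partial k (F2_pair p a k j)"
    unfolding F2_pair_def partial_sum
  proof (rule sum.cong[OF refl], clarify)
    fix r s assume rs: "(r, s) \<in> parts2 p"
    have h: "harm (r - 1) = (harm s :: 'a)" "harm (s - 1) = harm s - 1 / (of_nat s :: 'a)"
      using rs harm_reflect[of r s] harm_pred[of s, where ?'a = 'a]
      by (simp_all add: parts2_def)
    have cancel: "of_nat r * ((a k - a j) / of_nat r * c) = (a k - a j) * c" for c
      using parts2_of_nat(1)[OF rs] by simp
    have "- ((a k - a j) * (harm (s - 1) + harm (r - 1))) = of_nat r *
        ((a k - a j) / of_nat r * (1 / of_nat s - 2 * (\<Sum>d = 1..s. 1 / of_nat d)))"
      unfolding harm_def[of s, symmetric] h cancel by (simp add: algebra_simps)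
    then show "cst (- ((a k - a j) * (harm (s - 1) + harm (r - 1)))) * var k ^ (r - 1) * var j ^ s =
      partial k (cst ((a k - a j) / of_nat r * (1 / of_nat s - 2 * (\<Sum>d = 1..s. 1 / of_nat d)))
        * var k ^ r * var j ^ s)"
      by (simp only: partial_monom2[OF assms])
  qed
  finally show ?thesis by simp
qed

text \<open>The index pairs of the double sum with \<open>j\<close>, \<open>i\<close>,
  \<open>k\<close> distinct come from the triples of \<open>F2\<close>, those with
  \<open>i = j\<close> or \<open>i = k\<close> from its pairs.\<close>

lemma partial_F2:
  assumes k: "k \<in> {1..n}"
  shows "partial k (F2 p n a) =
    - (\<Sum>j\<in>{1..n} - {k}. \<Sum>i\<in>{1..n}. cst (a k - a j :: 'a) * log_tail p k j i)"
proof -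
  let ?J = "{1..n} - {k}"
  let ?P = "{(j, i). j \<in> ?J \<and> i \<in> ?J \<and> j < i}"
  let ?g = "\<lambda>j i. cst (a k - a j) * log_tail p k j i"
  have "(\<Sum>(i, j, l)\<in>{(i, j, l). i \<in> {1..n} \<and> j \<in> {1..n} \<and> l \<in> {1..n} \<and> i < j \<and> j < l}.
      partial k (F2_triple p a i j l)) = (\<Sum>(j, i)\<in>?P. partial k (F2_triple p a k j i))"
  proof (rule sum_triples_containing)
    show "i = k \<or> j = k \<or> l = k" if "partial k (F2_triple p a i j l) \<noteq> 0" for i j l
    proof (rule ccontr)
      assume "\<not> (i = k \<or> j = k \<or> l = k)"
      then have "partial k (F2_triple p a i j l) = 0"
        by (simp add: F2_triple_def partial_mult partial_sum partial_var_power case_prod_unfold)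
      with that show False ..
    qed
  qed (use k in \<open>auto intro: arg_cong[OF F2_triple_sym12] arg_cong[OF F2_triple_sym23]\<close>)
  also have "\<dots> = - (\<Sum>(j, i)\<in>?P. ?g j i + ?g i j)"
    unfolding sum_negf[symmetric] by (rule sum.cong) (auto simp: partial_F2_triple)
  finally have triples:
    "(\<Sum>(i, j, l)\<in>{(i, j, l). i \<in> {1..n} \<and> j \<in> {1..n} \<and> l \<in> {1..n} \<and> i < j \<and> j < l}.
      partial k (F2_triple p a i j l)) = - (\<Sum>(j, i)\<in>?P. ?g j i + ?g i j)" .
  have "(\<Sum>(i, j)\<in>{(i, j). i \<in> {1..n} \<and> j \<in> {1..n} \<and> i < j}. partial k (F2_pair p a i j)) =
      (\<Sum>j\<in>?J. partial k (F2_pair p a k j))"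
  proof (rule sum_pairs_containing)
    show "i = k \<or> j = k" if "partial k (F2_pair p a i j) \<noteq> 0" for i j
    proof (rule ccontr)
      assume "\<not> (i = k \<or> j = k)"
      then have "partial k (F2_pair p a i j) = 0"
        by (simp add: F2_pair_def partial_mult partial_sum partial_var_power case_prod_unfold)
      with that show False ..
    qed
  qed (use k in \<open>auto intro: arg_cong[OF F2_pair_sym]\<close>)
  also have "\<dots> = - (\<Sum>j\<in>?J. ?g j j + ?g j k)"
    unfolding sum_negf[symmetric] by (rule sum.cong) (auto simp: partial_F2_pair algebra_simps)
  finally have pairs:
    "(\<Sum>(i, j)\<in>{(i, j). i \<in> {1..n} \<and> j \<in> {1..n} \<and> i < j}. partial k (F2_pair p a i j)) =
      - (\<Sum>j\<in>?J. ?g j j + ?g j k)" .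
  have "partial k (F2 p n a) = - (\<Sum>(j, i)\<in>?P. ?g j i + ?g i j) - (\<Sum>j\<in>?J. ?g j j + ?g j k)"
    using triples pairs by (simp add: F2_eq partial_add partial_sum case_prod_unfold)
  \<comment> \<open>The triples supply the off-diagonal part and the terms \<open>?g j j\<close> the
    diagonal of a full square over \<open>?J\<close>; the column \<open>i = k\<close> is then
    added.\<close>
  also have "\<dots> = - ((\<Sum>j\<in>?J. \<Sum>i\<in>?J. ?g j i) + (\<Sum>j\<in>?J. ?g j k))"
    by (subst sum_square_split) (simp_all add: sum.distrib)
  also have "(\<Sum>j\<in>?J. \<Sum>i\<in>?J. ?g j i) + (\<Sum>j\<in>?J. ?g j k) = (\<Sum>j\<in>?J. \<Sum>i\<in>{1..n}. ?g j i)"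
    unfolding sum.distrib[symmetric]
    by (rule sum.cong[OF refl], subst add.commute, rule sum.remove[OF _ k, symmetric]) simp
  finally show ?thesis .
qed

end

theorem proposition5p10:
  fixes a :: "nat \<Rightarrow> 'p::prime_card mod_ring" and n p :: nat
  assumes p: "p = CARD('p)" "p \<noteq> 2"
    and n: "n > 0" "p dvd n"
    and a: "(\<Sum>i\<in>{1..n}. a i) = 0"
  shows "(\<forall>G. next_term p n (F0 p n a) G \<longleftrightarrow> G = F1 p n a) \<and>
         (\<forall>G. next_term p n (F1 p n a) G \<longleftrightarrow> G = F2 p n a)"
proof -
  have char: "CHAR('p mod_ring) = p" using p by simp
  have p_gt_2: "p > 2" using p prime_ge_2_nat[OF prime_card[where ?'a = 'p]] by simp
  then have p_pos: "p > 0" by simp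
  show ?thesis
    \<comment> \<open>In both steps, derivative and \<open>B\<close> have been brought to literally
      the same expression, so rewriting suffices.\<close>
    by (intro conjI allI; rule next_term_iff_eqI[OF char p_pos])
      (simp_all only: mixed_F1[OF char p_gt_2] mixed_F2 partial_F1[OF char p_gt_2]
        partial_F2[OF char p_gt_2] B_F0[OF char p_gt_2 n(2) a] B_F1[OF char p_gt_2 n(2) a])
qed

end
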